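(* Let $K,M\ge1$ be integers, $0<c_{\max}<\infty$, $a_0\in\mathbb R$, and for each $k=1,\dots,K$ let $\eta_{k,(1)}\le\cdots\le\eta_{k,(M)}$ be real numbers. Let $\widehat\Gamma_{k,M}$ be the empirical CPT functions, $h_{k,i}$ the ranked scenario contributions, and, for a closed interval $I=[\ell,u]\subset[0,c_{\max}]$, let $L_k(I),U_k(I)$ be $$L_k(I)=\sum_{i=1}^M\min\{h_{k,i}(a_0+\ell\eta_{k,(i)}),\,h_{k,i}(a_0+u\eta_{k,(i)})\},\qquad U_k(I)=\sum_{i=1}^M\max\{h_{k,i}(a_0+\ell\eta_{k,(i)}),\,h_{k,i}(a_0+u\eta_{k,(i)})\}$$ (all as defined in the context). (i) For every closed interval $I\subset[0,c_{\max}]$, every $c\in I$ and every $k=1,\dots,K$, $$L_k(I)\le\widehat\Gamma_{k,M}(c)\le U_k(I).$$ (ii) Consequently, with $U(I)=\min_{1\le k\le K}U_k(I)$, $$\sup_{c\in I}\min_{1\le k\le K}\widehat\Gamma_{k,M}(c)\le U(I).$$ (iii) Let $\mathcal P$ be a finite partition of $[0,c_{\max}]$ into closed intervals, let $\widehat c\in[0,c_{\max}]$ be any feasible point, and define $$\underline v=\min_{1\le k\le K}\widehat\Gamma_{k,M}(\widehat c),\qquad\overline v=\max_{I\in\mathcal P}U(I).$$ If every interval with upper bound $U(I)\le\underline v$ has been discarded and the remaining intervals cover every point of $[0,c_{\max}]$ not yet excluded (i.e. not lying in a discarded interval), then the finite-scenario optimum $v_M^*=\max_{0\le c\le c_{\max}}\min_{1\le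 k\le K}\widehat\Gamma_{k,M}(c)$ satisfies $$\underline v\le v_M^*\le\max\{\underline v,\overline v\}.$$ In particular, if $\max\{\underline v,\overline v\}-\underline v\le\varepsilon$, then $\widehat c$ is an $\varepsilon$-global solution, i.e. $0\le v_M^*-\min_k\widehat\Gamma_{k,M}(\widehat c)\le\varepsilon$.
   Context: CPT parameters: $0<\alpha_+,\alpha_-\le1$, $\lambda_\ell>1$, $\delta_+,\delta_->0$; probability weighting functions $w^\pm(p)=p^{\delta_\pm}/[p^{\delta_\pm}+(1-p)^{\delta_\pm}]^{1/\delta_\pm}$ on $[0,1]$, where $\delta_\pm$ are such that $w^+$ and $w^-$ are nondecreasing on $[0,1]$. Decision weights for $M$ equally weighted scenarios, $i=1,\dots,M$ (the same for every model $k$): $$\pi_{k,i}^-=w^-\!\left(\tfrac iM\right)-w^-\!\left(\tfrac{i-1}M\right),\qquad\pi_{k,i}^+=w^+\!\left(\tfrac{M-i+1}M\right)-w^+\!\left(\tfrac{M-i}M\right).$$ Empirical CPT function of model $k$ (with $a_0=r_f-r_0$ the risk-free return minus the reference return, and $\eta_{k,(i)}$ the ordered scenarios of the projected excess return): for $c\in[0,c_{\max}]$ put $y_{k,(i)}(c)=a_0+c\,\eta_{k,(i)}$ (nondecreasing in $i$) and $$\widehat\Gamma_{k,M}(c)=\sum_{i:\,y_{k,(i)}(c)\ge0}\pi_{k,i}^+\,y_{k,(i)}(c)^{\alpha_+}-\lambda_\ell\sum_{i:\,y_{k,(i)}(c)<0}\pi_{k,i}^-\,[-y_{k,(i)}(c)]^{\alpha_-}.$$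 Ranked scenario contribution: $h_{k,i}(y)=\pi_{k,i}^+y^{\alpha_+}$ for $y\ge0$ and $h_{k,i}(y)=-\lambda_\ell\pi_{k,i}^-(-y)^{\alpha_-}$ for $y<0$, so that $\widehat\Gamma_{k,M}(c)=\sum_{i=1}^Mh_{k,i}(a_0+c\,\eta_{k,(i)})$. *)

theory Defs
  imports "HOL-Analysis.Analysis"
begin

record cpt_params =
  gain_exponent :: real
  loss_exponent :: real
  loss_aversion :: real
  gain_delta :: real
  loss_delta :: real

definition prob_weight :: "real \<Rightarrow> real \<Rightarrow> real" where
  "prob_weight \<delta> p =
     p powr \<delta> / (p powr \<delta> + (1 - p) powr \<delta>) powr (1 / \<delta>)"

definition gain_weight :: "cpt_params \<Rightarrow> nat \<Rightarrow> nat \<Rightarrow> real" where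
  "gain_weight p M i =
     prob_weight (gain_delta p) ((real M - real i + 1) / real M)
     - prob_weight (gain_delta p) ((real M - real i) / real M)"

definition loss_weight :: "cpt_params \<Rightarrow> nat \<Rightarrow> nat \<Rightarrow> real" where
  "loss_weight p M i =
     prob_weight (loss_delta p) (real i / real M)
     - prob_weight (loss_delta p) ((real i - 1) / real M)"

text \<open>
  The weights do not depend on the model, so the functions below take the ordered scenarios
  \<open>\<eta> 1 \<le> \<dots> \<le> \<eta> M\<close> of one model; a family of models is indexed by \<open>{1..K}\<close>.
\<close>

definition empirical_cpt ::
  "cpt_params \<Rightarrow> nat \<Rightarrow> real \<Rightarrow> (nat \<Rightarrow> real) \<Rightarrow> real \<Rightarrow> real" where
  "empirical_cpt p M a0 \<eta> c =
     (\<Sum>i\<in>{i\<in>{1..M}. a0 + c * \<eta> i \<ge> 0}.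
        gain_weight p M i * (a0 + c * \<eta> i) powr gain_exponent p)
     - loss_aversion p *
       (\<Sum>i\<in>{i\<in>{1..M}. a0 + c * \<eta> i < 0}.
          loss_weight p M i * (- (a0 + c * \<eta> i)) powr loss_exponent p)"

definition ranked_contribution :: "cpt_params \<Rightarrow> nat \<Rightarrow> nat \<Rightarrow> real \<Rightarrow> real" where
  "ranked_contribution p M i y =
     (if y \<ge> 0 then gain_weight p M i * y powr gain_exponent p
      else - loss_aversion p * loss_weight p M i * (- y) powr loss_exponent p)"

text \<open>
  Intervals are sets, as in \<^const>\<open>division_of\<close>; \<^term>\<open>Inf I\<close> and \<^term>\<open>Sup I\<close> are
  the endpoints of a nonempty closed interval.
\<close>

definition interval_lower ::
  "cpt_params \<Rightarrow> nat \<Rightarrow> real \<Rightarrow> (nat \<Rightarrow> real) \<Rightarrow> real set \<Rightarrow> real" where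
  "interval_lower p M a0 \<eta> I =
     (\<Sum>i=1..M. min (ranked_contribution p M i (a0 + Inf I * \<eta> i))
                    (ranked_contribution p M i (a0 + Sup I * \<eta> i)))"

definition interval_upper ::
  "cpt_params \<Rightarrow> nat \<Rightarrow> real \<Rightarrow> (nat \<Rightarrow> real) \<Rightarrow> real set \<Rightarrow> real" where
  "interval_upper p M a0 \<eta> I =
     (\<Sum>i=1..M. max (ranked_contribution p M i (a0 + Inf I * \<eta> i))
                    (ranked_contribution p M i (a0 + Sup I * \<eta> i)))"

lemma interval_bounds_atLeastAtMost:
  assumes "l \<le> u"
  shows "interval_lower p M a0 \<eta> {l..u} =
      (\<Sum>i=1..M. min (ranked_contribution p M i (a0 + l * \<eta> i))
                     (ranked_contribution p M i (a0 + u * \<eta> i)))"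
    and "interval_upper p M a0 \<eta> {l..u} =
      (\<Sum>i=1..M. max (ranked_contribution p M i (a0 + l * \<eta> i))
                     (ranked_contribution p M i (a0 + u * \<eta> i)))"
  using assms by (simp_all add: interval_lower_def interval_upper_def)

definition worst_case_cpt ::
  "cpt_params \<Rightarrow> nat \<Rightarrow> nat \<Rightarrow> real \<Rightarrow> (nat \<Rightarrow> nat \<Rightarrow> real) \<Rightarrow> real \<Rightarrow> real" where
  "worst_case_cpt p K M a0 \<eta> c = (MIN k\<in>{1..K}. empirical_cpt p M a0 (\<eta> k) c)"

definition worst_case_upper ::
  "cpt_params \<Rightarrow> nat \<Rightarrow> nat \<Rightarrow> real \<Rightarrow> (nat \<Rightarrow> nat \<Rightarrow> real) \<Rightarrow> real set \<Rightarrow> real" where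
  "worst_case_upper p K M a0 \<eta> I = (MIN k\<in>{1..K}. interval_upper p M a0 (\<eta> k) I)"

end

theory Submission
  imports Defs
begin

text \<open>
  A ranked contribution is a nondecreasing function of the projected return, and the return is
  affine in \<open>c\<close>; hence on an interval every summand lies between its values at the two endpoints,
  whatever the sign of the scenario. Continuity makes the supremum a maximum, and the maximiser lies
  in some interval of the partition, whose upper bound therefore dominates the optimum.
\<close>

text \<open>For \<open>1 \<le> i \<le> M\<close> the arguments \<open>(M - i) / M\<close>,
  \<open>(M - i + 1) / M\<close> and \<open>(i - 1) / M\<close>, \<open>i / M\<close> are adjacent
  grid points of [0,1], so each weight is an increment of a nondecreasing function.\<close>

lemma weights_nonneg:
  assumes "1 \<le> i" "i \<le> M"
  shows gain_weight_nonneg: "mono_on {0..1} (prob_weight (gain_delta p)) \<Longrightarrow> 0 \<le> gain_weight p M i"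
    and loss_weight_nonneg: "mono_on {0..1} (prob_weight (loss_delta p)) \<Longrightarrow> 0 \<le> loss_weight p M i"
proof -
  show "0 \<le> gain_weight p M i" if "mono_on {0..1} (prob_weight (gain_delta p))"
    using mono_onD[OF that, of "(real M - real i) / real M" "(real M - real i + 1) / real M"] assms
    by (auto simp: gain_weight_def field_simps)
  show "0 \<le> loss_weight p M i" if "mono_on {0..1} (prob_weight (loss_delta p))"
    using mono_onD[OF that, of "(real i - 1) / real M" "real i / real M"] assms
    by (auto simp: loss_weight_def field_simps)
qed

text \<open>The two branches merge because \<^term>\<open>0 powr a = (0::real)\<close>.\<close>

lemma ranked_contribution_conv_max:
  "ranked_contribution p M i y =
     gain_weight p M i * max 0 y powr gain_exponent p
     - loss_aversion p * loss_weight p M i * max 0 (- y) powr loss_exponent p"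
  by (auto simp: ranked_contribution_def max_def)

text \<open>In the merged form no case split on signs arises: \<open>max 0 y\<close> grows and
  \<open>max 0 (- y)\<close> shrinks with \<open>y\<close>, powers preserve the order of nonnegative
  bases, and the loss term is subtracted.\<close>

lemma mono_ranked_contribution:
  assumes "0 \<le> gain_exponent p" "0 \<le> loss_exponent p" "0 \<le> loss_aversion p"
    and "0 \<le> gain_weight p M i" "0 \<le> loss_weight p M i"
  shows "mono (ranked_contribution p M i)"
  unfolding ranked_contribution_conv_max
  by (intro monoI diff_mono mult_left_mono powr_mono2 mult_nonneg_nonneg assms) auto

text \<open>Strictly positive exponents make \<open>powr\<close> continuous at base 0. With exponent
  0 it would jump there from 0 to 1.\<close>

lemma continuous_on_ranked_contribution:
  assumes "0 < gain_exponent p" "0 < loss_exponent p"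
  shows "continuous_on A (ranked_contribution p M i)"
  unfolding ranked_contribution_conv_max using assms
  by (intro continuous_intros continuous_on_powr') auto

lemma empirical_cpt_eq_sum_ranked_contribution:
  "empirical_cpt p M a0 \<eta> c = (\<Sum>i=1..M. ranked_contribution p M i (a0 + c * \<eta> i))"
  \<comment> \<open>\<open>sum.If_cases\<close> splits the single sum by the sign of the projected
    return, matching the gain and loss sums of \<open>empirical_cpt\<close>.\<close>
  unfolding empirical_cpt_def ranked_contribution_def sum.If_cases[OF finite_atLeastAtMost]
  by (simp add: sum_distrib_left sum_negf mult.assoc Int_def not_le)

lemma mono_affine_between:
  fixes f :: "real \<Rightarrow> real"
  assumes "mono f" and c: "c \<in> {l..u}"
  shows "min (f (a + l * m)) (f (a + u * m)) \<le> f (a + c * m)"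
    and "f (a + c * m) \<le> max (f (a + l * m)) (f (a + u * m))"
proof -
  \<comment> \<open>The sign of \<open>m\<close> fixes the direction of the affine map: the first
    disjunct is the case \<open>0 \<le> m\<close>, the second \<open>m < 0\<close>. Either one
    yields both bounds.\<close>
  have "f (a + l * m) \<le> f (a + c * m) \<and> f (a + c * m) \<le> f (a + u * m) \<or>
        f (a + u * m) \<le> f (a + c * m) \<and> f (a + c * m) \<le> f (a + l * m)"
  proof (cases "0 \<le> m")
    case True
    then show ?thesis
      using c by (auto intro!: monoD[OF \<open>mono f\<close>] mult_right_mono)
  next
    case False
    then show ?thesis
      using c by (auto intro!: monoD[OF \<open>mono f\<close>] mult_right_mono_neg)
  qed
  then show "min (f (a + l * m)) (f (a + u * m)) \<le> f (a + c * m)"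
    and "f (a + c * m) \<le> max (f (a + l * m)) (f (a + u * m))"
    by auto
qed

lemma empirical_cpt_between_interval_bounds:
  assumes "\<And>i. i \<in> {1..M} \<Longrightarrow> mono (ranked_contribution p M i)" and "c \<in> {l..u}"
  shows "interval_lower p M a0 \<eta> {l..u} \<le> empirical_cpt p M a0 \<eta> c"
    and "empirical_cpt p M a0 \<eta> c \<le> interval_upper p M a0 \<eta> {l..u}"
proof -
  from \<open>c \<in> {l..u}\<close> have "l \<le> u" by simp
  then show "interval_lower p M a0 \<eta> {l..u} \<le> empirical_cpt p M a0 \<eta> c"
    and "empirical_cpt p M a0 \<eta> c \<le> interval_upper p M a0 \<eta> {l..u}"
    unfolding empirical_cpt_eq_sum_ranked_contribution interval_bounds_atLeastAtMost[OF \<open>l \<le> u\<close>]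
    using assms by (auto intro!: sum_mono mono_affine_between)
qed

text \<open>The induction starts at singletons, since \<open>Min\<close> of the empty set is
  unspecified; each insertion is a binary \<open>min\<close> of continuous functions.\<close>

lemma continuous_on_Min_image:
  fixes f :: "'i \<Rightarrow> 'a::topological_space \<Rightarrow> 'b::linorder_topology"
  assumes "finite I" "I \<noteq> {}" "\<And>i. i \<in> I \<Longrightarrow> continuous_on A (f i)"
  shows "continuous_on A (\<lambda>x. MIN i\<in>I. f i x)"
  using assms by (induction I rule: finite_ne_induct) (auto intro: continuous_on_min)

lemma continuous_on_worst_case_cpt:
  assumes "0 < gain_exponent p" "0 < loss_exponent p" "1 \<le> K"
  shows "continuous_on A (worst_case_cpt p K M a0 \<eta>)"
  unfolding worst_case_cpt_def empirical_cpt_eq_sum_ranked_contribution using assms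
  by (auto intro!: continuous_on_Min_image continuous_intros
      \<comment> \<open>Taking \<open>UNIV\<close> as outer domain makes the range condition on the
        inner affine map trivial.\<close>
      continuous_on_compose2[OF continuous_on_ranked_contribution[where A = UNIV]])

lemma worst_case_cpt_le_worst_case_upper:
  assumes "\<And>i. i \<in> {1..M} \<Longrightarrow> mono (ranked_contribution p M i)" and "c \<in> {l..u}" and "1 \<le> K"
  shows "worst_case_cpt p K M a0 \<eta> c \<le> worst_case_upper p K M a0 \<eta> {l..u}"
  unfolding worst_case_upper_def
\<comment> \<open>A lower bound for the minimum of the upper bounds is checked model by model: the
  worst case is at most the value of model \<open>k\<close>, which is at most its own interval
  bound.\<close>
proof (rule Min.boundedI)
  fix x assume "x \<in> (\<lambda>k. interval_upper p M a0 (\<eta> k) {l..u}) ` {1..K}"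
  then obtain k where k: "k \<in> {1..K}" "x = interval_upper p M a0 (\<eta> k) {l..u}"
    by blast
  have "worst_case_cpt p K M a0 \<eta> c \<le> empirical_cpt p M a0 (\<eta> k) c"
    unfolding worst_case_cpt_def using k by (intro Min_le) auto
  also have "\<dots> \<le> x"
    unfolding k using assms(1,2) by (rule empirical_cpt_between_interval_bounds(2))
  finally show "worst_case_cpt p K M a0 \<eta> c \<le> x" .
qed (use \<open>1 \<le> K\<close> in auto)

lemma le_Max_over_division:
  fixes f :: "real \<Rightarrow> real"
  assumes "\<P> division_of S" and "c \<in> S"
    and "\<And>l u. c \<in> {l..u} \<Longrightarrow> f c \<le> U {l..u}"
  shows "f c \<le> (MAX I\<in>\<P>. U I)"
proof -
  obtain I where "I \<in> \<P>" "c \<in> I"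
    using assms(1,2) by (auto simp: division_of_def)
  \<comment> \<open>Members of a division are given as \<open>cbox\<close>, which on the reals is a
    closed interval.\<close>
  moreover obtain l u where "I = {l..u}"
    using division_ofD(4)[OF assms(1) \<open>I \<in> \<P>\<close>] by auto
  moreover have "finite \<P>"
    using assms(1) by (rule division_ofD(1))
  ultimately show ?thesis
    using assms(3)[of l u] by (subst Max_ge_iff) auto
qed

theorem proposition3:
  fixes p :: cpt_params
    and K M :: nat
    and c_max a0 :: real
    and \<eta> :: "nat \<Rightarrow> nat \<Rightarrow> real"
  assumes "0 < gain_exponent p" and "gain_exponent p \<le> 1"
    and "0 < loss_exponent p" and "loss_exponent p \<le> 1"
    and "1 < loss_aversion p"
    and "0 < gain_delta p" and "0 < loss_delta p"
    and "mono_on {0..1} (prob_weight (gain_delta p))"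
    and "mono_on {0..1} (prob_weight (loss_delta p))"
    and "1 \<le> K" and "1 \<le> M" and "0 < c_max"
    and "\<forall>k\<in>{1..K}. mono_on {1..M} (\<eta> k)"
  shows
    "(\<forall>l u c k. 0 \<le> l \<and> l \<le> u \<and> u \<le> c_max \<and> c \<in> {l..u} \<and> k \<in> {1..K} \<longrightarrow>
        interval_lower p M a0 (\<eta> k) {l..u} \<le> empirical_cpt p M a0 (\<eta> k) c \<and>
        empirical_cpt p M a0 (\<eta> k) c \<le> interval_upper p M a0 (\<eta> k) {l..u})
     \<and>
     (\<forall>l u. 0 \<le> l \<and> l \<le> u \<and> u \<le> c_max \<longrightarrow>
        (SUP c\<in>{l..u}. worst_case_cpt p K M a0 \<eta> c) \<le> worst_case_upper p K M a0 \<eta> {l..u})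
     \<and>
     (let v_star = (SUP c\<in>{0..c_max}. worst_case_cpt p K M a0 \<eta> c) in
        (\<exists>c\<in>{0..c_max}. worst_case_cpt p K M a0 \<eta> c = v_star) \<and>
        (\<forall>\<P> \<D> c_hat.
           let v_lo = worst_case_cpt p K M a0 \<eta> c_hat;
               v_hi = (MAX I\<in>\<P>. worst_case_upper p K M a0 \<eta> I)
           in \<P> division_of {0..c_max} \<and> c_hat \<in> {0..c_max} \<and>
              \<D> \<subseteq> \<P> \<and>
              (\<forall>I\<in>\<P>. worst_case_upper p K M a0 \<eta> I \<le> v_lo \<longrightarrow> I \<in> \<D>) \<and>
              {0..c_max} - \<Union>\<D> \<subseteq> \<Union>(\<P> - \<D>) \<longrightarrow>
              v_lo \<le> v_star \<and> v_star \<le> max v_lo v_hi \<and>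
              (\<forall>\<epsilon>. max v_lo v_hi - v_lo \<le> \<epsilon> \<longrightarrow>
                 0 \<le> v_star - v_lo \<and> v_star - v_lo \<le> \<epsilon>)))"
proof -
  note ge1K = \<open>1 \<le> K\<close>
  have mono: "mono (ranked_contribution p M i)" if "i \<in> {1..M}" for i
    using that assms by (intro mono_ranked_contribution weights_nonneg) auto
  have upper: "worst_case_cpt p K M a0 \<eta> c \<le> worst_case_upper p K M a0 \<eta> {l..u}"
    if "c \<in> {l..u}" for c l u
    using mono that ge1K by (rule worst_case_cpt_le_worst_case_upper)
  define v where "v = (SUP c\<in>{0..c_max}. worst_case_cpt p K M a0 \<eta> c)"
  have "continuous_on {0..c_max} (worst_case_cpt p K M a0 \<eta>)"
    using assms by (intro continuous_on_worst_case_cpt) auto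
  then obtain c0 where c0: "c0 \<in> {0..c_max}"
    and c0_max: "\<forall>c\<in>{0..c_max}. worst_case_cpt p K M a0 \<eta> c \<le> worst_case_cpt p K M a0 \<eta> c0"
    using continuous_attains_sup[of "{0..c_max}"] \<open>0 < c_max\<close> by force
  \<comment> \<open>Attainment turns the supremum into a value at one point, so later bounds on
    \<open>v\<close> reduce to pointwise ones.\<close>
  have v: "v = worst_case_cpt p K M a0 \<eta> c0"
    unfolding v_def using c0 c0_max by (intro cSup_eq_maximum) auto
  show ?thesis
    unfolding Let_def v_def[symmetric]
  proof (intro conjI allI impI)
    fix l u c :: real and k
    assume "0 \<le> l \<and> l \<le> u \<and> u \<le> c_max \<and> c \<in> {l..u} \<and> k \<in> {1..K}"
    then have "c \<in> {l..u}" by simp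
    with mono show "interval_lower p M a0 (\<eta> k) {l..u} \<le> empirical_cpt p M a0 (\<eta> k) c"
      and "empirical_cpt p M a0 (\<eta> k) c \<le> interval_upper p M a0 (\<eta> k) {l..u}"
      by (blast intro: empirical_cpt_between_interval_bounds)+
  next
    fix l u :: real
    assume "0 \<le> l \<and> l \<le> u \<and> u \<le> c_max"
    then show "(SUP c\<in>{l..u}. worst_case_cpt p K M a0 \<eta> c) \<le> worst_case_upper p K M a0 \<eta> {l..u}"
      by (intro cSUP_least upper) auto
  next
    show "\<exists>c\<in>{0..c_max}. worst_case_cpt p K M a0 \<eta> c = v"
      using c0 v by auto
  next
    fix \<P> \<D> :: "real set set" and c_hat \<epsilon>
    let ?lo = "worst_case_cpt p K M a0 \<eta> c_hat"
    let ?hi = "MAX I\<in>\<P>. worst_case_upper p K M a0 \<eta> I"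
    assume *: "\<P> division_of {0..c_max} \<and> c_hat \<in> {0..c_max} \<and> \<D> \<subseteq> \<P> \<and>
              (\<forall>I\<in>\<P>. worst_case_upper p K M a0 \<eta> I \<le> ?lo \<longrightarrow> I \<in> \<D>) \<and>
              {0..c_max} - \<Union>\<D> \<subseteq> \<Union>(\<P> - \<D>)"
    then show lo: "?lo \<le> v"
      using c0_max v by simp
    \<comment> \<open>The maximiser \<open>c0\<close> lies in some member of \<open>\<P>\<close>,
      and \<open>?hi\<close> ranges over all of \<open>\<P>\<close>.\<close>
    have "v \<le> ?hi"
      unfolding v using * c0 upper by (intro le_Max_over_division) auto
    then show hi: "v \<le> max ?lo ?hi"
      by simp
    assume "max ?lo ?hi - ?lo \<le> \<epsilon>"
    with lo hi show "0 \<le> v - ?lo" and "v - ?lo \<le> \<epsilon>"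
      by linarith+
  qed
qed

end
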